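(* Let $T_e$ be the disjoint union of a triangle and an edge (5 vertices, 4 edges). Then $g(n,T_e)=O(\log n)$ as $n\to\infty$.
   Context: For a positive integer $n$ and a graph $H$: for each vertex $v$ of the complete graph $K_n$ let $f_v$ be a (not necessarily proper) colouring of the edges of the same $K_n$. The collection $\{f_v\}$ is called $(n,H)$-local if for every copy $T$ of $H$ in $K_n$ (i.e. every subgraph of $K_n$ isomorphic to $H$), there exists a vertex $u\in V(T)$ such that all edges of $T$ receive pairwise different colours in $f_u$. $g(n,H)$ is the smallest $k$ for which there is an $(n,H)$-local collection of colourings each using at most $k$ colours. *)

theory Defs
  imports Complex_Main "HOL-Library.Landau_Symbols"
begin

type_synonym 'a graph = "'a set \<times> 'a set set"

abbreviation verts :: "'a graph \<Rightarrow> 'a set" where "verts G \<equiv> fst G"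
abbreviation edges :: "'a graph \<Rightarrow> 'a set set" where "edges G \<equiv> snd G"

definition simple_graph :: "'a graph \<Rightarrow> bool" where
  "simple_graph G \<longleftrightarrow> (\<forall>e\<in>edges G. e \<subseteq> verts G \<and> card e = 2)"

definition subgraph :: "'a graph \<Rightarrow> 'a graph \<Rightarrow> bool" where
  "subgraph T G \<longleftrightarrow> simple_graph T \<and> verts T \<subseteq> verts G \<and> edges T \<subseteq> edges G"

definition graph_iso :: "'a graph \<Rightarrow> 'b graph \<Rightarrow> bool" where
  "graph_iso G H \<longleftrightarrow>
     (\<exists>\<phi>. bij_betw \<phi> (verts G) (verts H) \<and> (\<lambda>e. \<phi> ` e) ` edges G = edges H)"

definition complete_graph :: "nat \<Rightarrow> nat graph" where
  "complete_graph n = ({..<n}, {e. e \<subseteq> {..<n} \<and> card e = 2})"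

text \<open>A copy is a subgraph, not necessarily induced.\<close>
definition copies :: "'a graph \<Rightarrow> 'b graph \<Rightarrow> 'b graph set" where
  "copies H G = {T. subgraph T G \<and> graph_iso H T}"

text \<open>
  The colouring attached to the vertex \<open>v\<close> is \<open>f v\<close>; only the vertices \<open>v < n\<close> and
  the values of \<open>f v\<close> on the edges of the complete graph matter.
\<close>
definition local_collection ::
    "nat \<Rightarrow> 'a graph \<Rightarrow> (nat \<Rightarrow> nat set \<Rightarrow> 'c) \<Rightarrow> bool" where
  "local_collection n H f \<longleftrightarrow>
     (\<forall>T\<in>copies H (complete_graph n). \<exists>u\<in>verts T. inj_on (f u) (edges T))"

definition uses_at_most :: "nat \<Rightarrow> nat \<Rightarrow> (nat \<Rightarrow> nat set \<Rightarrow> 'c) \<Rightarrow> bool" where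
  "uses_at_most k n f \<longleftrightarrow>
     (\<forall>v\<in>verts (complete_graph n). card (f v ` edges (complete_graph n)) \<le> k)"

text \<open>
  Natural numbers suffice as colours, since the complete graph has finitely many edges.
\<close>
definition local_colour_number :: "nat \<Rightarrow> 'a graph \<Rightarrow> nat" where
  "local_colour_number n H =
     (LEAST k. \<exists>f :: nat \<Rightarrow> nat set \<Rightarrow> nat. local_collection n H f \<and> uses_at_most k n f)"

definition triangle_plus_edge :: "nat graph" where
  "triangle_plus_edge = ({0, 1, 2, 3, 4}, {{0, 1}, {0, 2}, {1, 2}, {3, 4}})"

lemma local_colour_number_attained:
  fixes H :: "'a graph"
  assumes "verts H \<noteq> {}"
  shows "\<exists>f :: nat \<Rightarrow> nat set \<Rightarrow> nat.
           local_collection n H f \<and> uses_at_most (local_colour_number n H) n f"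
proof -
  let ?E = "edges (complete_graph n)"
  have "finite ?E"
    by (rule finite_subset[of _ "Pow {..<n}"]) (auto simp: complete_graph_def)
  then obtain c :: "nat set \<Rightarrow> nat" where c: "inj_on c ?E"
    using finite_imp_inj_to_nat_seg by blast
  have "local_collection n H (\<lambda>_. c)"
    unfolding local_collection_def
  proof
    fix T assume "T \<in> copies H (complete_graph n)"
    then have "verts T \<noteq> {}" "edges T \<subseteq> ?E"
      using assms by (auto simp: copies_def graph_iso_def subgraph_def bij_betw_def)
    then show "\<exists>u\<in>verts T. inj_on c (edges T)"
      using c inj_on_subset by blast
  qed
  moreover have "uses_at_most (card (c ` ?E)) n (\<lambda>_. c)"
    by (simp add: uses_at_most_def)
  ultimately show ?thesis
    unfolding local_colour_number_def by (intro LeastI) blast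
qed

end

theory Submission
  imports Defs "HOL-Library.Countable"
begin

text \<open>
  Let \<open>level e\<close> be the height at which the endpoints of \<open>e\<close>, seen as leaves of the binary tree,
  first meet, and let \<open>f\<^sub>u e\<close> record \<open>level e\<close>, whether \<open>u \<in> e\<close>, and how many endpoints of \<open>e\<close>
  lie below \<open>u\<close>.  Every triangle has vertices \<open>a < b\<close> and \<open>c\<close>, with \<open>c\<close> not between \<open>a\<close> and \<open>b\<close>,
  such that the level of \<open>ab\<close> differs from those of \<open>ac\<close> and \<open>bc\<close>.  Let \<open>de\<close> be a disjoint edge.
  If one of \<open>d\<close>, \<open>e\<close> lies between \<open>a\<close> and \<open>b\<close>, then its colouring separates \<open>ac\<close> from \<open>bc\<close> and
  works.  Otherwise \<open>f\<^sub>a\<close> and \<open>f\<^sub>b\<close> count the same number of endpoints of \<open>de\<close>, whereas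
  the count of \<open>ac\<close> at \<open>b\<close> exceeds that of \<open>bc\<close> at \<open>a\<close> by one, so \<open>f\<^sub>a\<close> or \<open>f\<^sub>b\<close> works.
\<close>

section \<open>Levels of pairs of leaves in the binary tree\<close>

definition level :: "nat set \<Rightarrow> nat" where
  "level e = (LEAST i. \<forall>x\<in>e. \<forall>y\<in>e. x div 2 ^ i = y div 2 ^ i)"

lemma div_pow2_eq_mono:
  fixes x y :: nat
  assumes "x div 2 ^ i = y div 2 ^ i" "i \<le> j"
  shows "x div 2 ^ j = y div 2 ^ j"
proof -
  have "z div 2 ^ j = z div 2 ^ i div 2 ^ (j - i)" for z :: nat
    using assms(2) by (simp add: div_mult2_eq[symmetric] power_add[symmetric])
  then show ?thesis using assms(1) by simp
qed

text \<open>\<open>x div 2 ^ i\<close> is the ancestor of the leaf \<open>x\<close> at height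
  \<open>i\<close>. Leaves that share an ancestor share all higher ones.\<close>

lemma level_le_iff: "level {x, y} \<le> i \<longleftrightarrow> x div 2 ^ i = y div 2 ^ i"
proof -
  define P where "P i \<longleftrightarrow> x div 2 ^ i = y div 2 ^ i" for i :: nat
  have level: "level {x, y} = (LEAST i. P i)"
    unfolding level_def P_def by (rule arg_cong[where f = Least]) auto
  have "x < 2 ^ (x + y)" "y < 2 ^ (x + y)"
    by (rule le_less_trans[OF _ less_exp], simp)+
  then have "P (x + y)" by (simp add: P_def)
  then have "P (level {x, y})" unfolding level by (rule LeastI)
  then have "P i" if "level {x, y} \<le> i"
    using that unfolding P_def by (rule div_pow2_eq_mono)
  moreover have "level {x, y} \<le> i" if "P i"
    unfolding level using that by (rule Least_le)
  ultimately show ?thesis unfolding P_def by blast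
qed

text \<open>A node has only two children: with equal levels, the ancestors of \<open>x\<close>,
  \<open>y\<close>, \<open>z\<close> one step below the common meeting height would be three
  distinct children of one node.\<close>

lemma level_adjacent_neq:
  assumes "x < y" "y < z"
  shows "level {x, y} \<noteq> level {y, z}"
proof
  assume eq: "level {x, y} = level {y, z}"
  have "\<not> level {x, y} \<le> 0" using assms by (simp only: level_le_iff) simp
  then obtain j where j: "level {x, y} = Suc j" using not0_implies_Suc by auto
  have "x div 2 ^ j \<noteq> y div 2 ^ j" "y div 2 ^ j \<noteq> z div 2 ^ j"
    using j eq by (simp_all flip: level_le_iff)
  moreover have "x div 2 ^ j \<le> y div 2 ^ j" "y div 2 ^ j \<le> z div 2 ^ j"
    using assms by (simp_all add: div_le_mono)
  moreover have "x div 2 ^ j div 2 = z div 2 ^ j div 2"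
    using level_le_iff[of x y "Suc j"] level_le_iff[of y z "Suc j"] j eq
    by (simp add: div_mult2_eq[of _ "2 ^ j" 2] power_Suc2 del: power_Suc)
  ultimately show False by linarith
qed

text \<open>The leaves below a node form an interval, so a node above \<open>x\<close> and
  \<open>z\<close> is also above \<open>y\<close>.\<close>

lemma level_outer:
  assumes "x < y" "y < z"
  shows "level {x, z} = max (level {x, y}) (level {y, z})"
proof -
  have "level {x, z} \<le> i \<longleftrightarrow> max (level {x, y}) (level {y, z}) \<le> i" for i
    using div_le_mono[of x y "2 ^ i"] div_le_mono[of y z "2 ^ i"] assms
    by (auto simp: level_le_iff)
  then show ?thesis by (meson dual_order.antisym order_refl)
qed

section \<open>The exceptional edge of a triangle\<close>

definition detached :: "nat \<Rightarrow> nat \<Rightarrow> nat \<Rightarrow> bool" where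
  "detached a b c \<longleftrightarrow> a < b \<and> (c < a \<or> b < c) \<and>
     level {a, b} \<noteq> level {a, c} \<and> level {a, b} \<noteq> level {b, c}"

text \<open>Of the two adjacent pairs, the one with the smaller level is exceptional, since the
  outer pair takes the larger level.\<close>

lemma detached_sorted:
  assumes "x < y" "y < z"
  shows "detached x y z \<or> detached y z x"
  using assms level_adjacent_neq[OF assms] level_outer[OF assms]
  by (auto simp: detached_def insert_commute max_def)

lemma detached_exists:
  assumes "a \<noteq> b" "a \<noteq> c" "b \<noteq> c"
  obtains p q r where "detached p q r" "{p, q, r} = {a, b, c}"
    "{{p, q}, {p, r}, {q, r}} = {{a, b}, {a, c}, {b, c}}"
proof -
  obtain x y z where "x < y" "y < z" and v: "{x, y, z} = {a, b, c}"
    and e: "{{x, y}, {x, z}, {y, z}} = {{a, b}, {a, c}, {b, c}}"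
  proof -
    consider "a < b" "b < c" | "a < c" "c < b" | "b < a" "a < c" | "b < c" "c < a"
      | "c < a" "a < b" | "c < b" "b < a"
      using assms by linarith
    then show thesis
      using that[of a b c] that[of a c b] that[of b a c] that[of b c a] that[of c a b] that[of c b a]
      by cases (simp_all add: insert_commute)
  qed
  from detached_sorted[OF this(1,2)] show thesis
  proof
    assume "detached x y z"
    then show thesis using v e by (rule that)
  next
    assume "detached y z x"
    moreover have "{y, z, x} = {a, b, c}" "{{y, z}, {y, x}, {z, x}} = {{a, b}, {a, c}, {b, c}}"
      unfolding v[symmetric] e[symmetric] by (auto simp: insert_commute)
    ultimately show thesis by (rule that)
  qed
qed

section \<open>The colouring and rainbow copies\<close>

definition tree_colour :: "nat \<Rightarrow> nat set \<Rightarrow> nat" where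
  "tree_colour u e = to_nat (level e, u \<in> e, card {v \<in> e. v < u})"

lemma card_below:
  assumes "x \<noteq> y"
  shows "card {v \<in> {x, y}. v < (u::nat)} = of_bool (x < u) + of_bool (y < u)"
proof -
  have "{v \<in> {x, y}. v < u} = (if x < u then {x} else {}) \<union> (if y < u then {y} else {})"
    by auto
  then show ?thesis using assms by simp
qed

lemma tree_colour_eq_iff:
  assumes "x \<noteq> y" "x' \<noteq> y'"
  shows "tree_colour u {x, y} = tree_colour u {x', y'} \<longleftrightarrow>
     level {x, y} = level {x', y'} \<and> (u \<in> {x, y} \<longleftrightarrow> u \<in> {x', y'}) \<and>
     of_bool (x < u) + of_bool (y < u) = (of_bool (x' < u) + of_bool (y' < u) :: nat)"
  unfolding tree_colour_def card_below[OF assms(1)] card_below[OF assms(2)] by simp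

lemma inj_on_four:
  assumes "f A \<noteq> f B" "f A \<noteq> f C" "f A \<noteq> f D" "f B \<noteq> f C" "f B \<noteq> f D" "f C \<noteq> f D"
  shows "inj_on f {A, B, C, D}"
  using assms by (auto simp: inj_on_def)

lemma tree_colour_neq_if_level:
  assumes "level e \<noteq> level e'"
  shows "tree_colour u e \<noteq> tree_colour u e'"
  using assms by (simp add: tree_colour_def)

lemma tree_colour_neq_if_mem:
  assumes "(u \<in> e) \<noteq> (u \<in> e')"
  shows "tree_colour u e \<noteq> tree_colour u e'"
  using assms by (simp add: tree_colour_def)

lemma rainbow_between:
  assumes det: "detached a b c" and dist: "distinct [a, b, c, u, w]" and u: "a < u" "u < b"
  shows "inj_on (tree_colour u) {{a, b}, {a, c}, {b, c}, {u, w}}"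
proof (rule inj_on_four)
  show "tree_colour u {a, b} \<noteq> tree_colour u {a, c}" "tree_colour u {a, b} \<noteq> tree_colour u {b, c}"
    using det by (simp_all add: detached_def tree_colour_neq_if_level)
  show "tree_colour u {a, b} \<noteq> tree_colour u {u, w}" "tree_colour u {a, c} \<noteq> tree_colour u {u, w}"
    "tree_colour u {b, c} \<noteq> tree_colour u {u, w}"
    by (rule tree_colour_neq_if_mem; use dist in auto)+
  have "a \<noteq> c" "b \<noteq> c" using dist by simp_all
  \<comment> \<open>The vertex \<open>c\<close> adds the same to both counts, while \<open>a\<close>
    lies below \<open>u\<close> and \<open>b\<close> does not.\<close>
  then show "tree_colour u {a, c} \<noteq> tree_colour u {b, c}"
    using u by (subst tree_colour_eq_iff) auto
qed

lemma rainbow_endpoint: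
  assumes det: "detached a b c" and dist: "distinct [a, b, c, d, e]"
    and out: "(d < a) = (d < b)" "(e < a) = (e < b)"
  shows "\<exists>u\<in>{a, b}. inj_on (tree_colour u) {{a, b}, {a, c}, {b, c}, {d, e}}"
proof -
  have neq: "a \<noteq> c" "b \<noteq> c" "d \<noteq> e" using dist by simp_all
  have lev: "tree_colour u {a, b} \<noteq> tree_colour u {a, c}"
    "tree_colour u {a, b} \<noteq> tree_colour u {b, c}" for u
    using det by (simp_all add: detached_def tree_colour_neq_if_level)
  have mem: "tree_colour a {a, b} \<noteq> tree_colour a {d, e}" "tree_colour a {a, c} \<noteq> tree_colour a {d, e}"
    "tree_colour a {a, c} \<noteq> tree_colour a {b, c}"
    "tree_colour b {a, b} \<noteq> tree_colour b {d, e}" "tree_colour b {b, c} \<noteq> tree_colour b {d, e}"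
    "tree_colour b {a, c} \<noteq> tree_colour b {b, c}"
    by (rule tree_colour_neq_if_mem; use dist in auto)+
  \<comment> \<open>At \<open>a\<close> and at \<open>b\<close>, only the triangle edge opposite to
    the colouring vertex can still share its colour with \<open>{d, e}\<close>.\<close>
  have "tree_colour a {b, c} \<noteq> tree_colour a {d, e} \<or> tree_colour b {a, c} \<noteq> tree_colour b {d, e}"
  proof (rule ccontr)
    assume "\<not> ?thesis"
    then have "tree_colour a {b, c} = tree_colour a {d, e}" "tree_colour b {a, c} = tree_colour b {d, e}"
      by simp_all
    then have "of_bool (b < a) + of_bool (c < a) = (of_bool (d < a) + of_bool (e < a) :: nat)"
      "of_bool (a < b) + of_bool (c < b) = (of_bool (d < b) + of_bool (e < b) :: nat)"
      unfolding tree_colour_eq_iff[OF neq(2,3)] tree_colour_eq_iff[OF neq(1,3)] by simp_all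
    moreover have "a < b" "\<not> b < a" "(c < a) = (c < b)" using det by (auto simp: detached_def)
    \<comment> \<open>By \<open>out\<close> the two right-hand sides agree, but the left-hand sides
      differ by the contribution of \<open>a < b\<close>.\<close>
    ultimately show False using out by simp
  qed
  then show ?thesis
  proof
    assume "tree_colour a {b, c} \<noteq> tree_colour a {d, e}"
    then have "inj_on (tree_colour a) {{a, b}, {a, c}, {b, c}, {d, e}}"
      by (intro inj_on_four lev mem)
    then show ?thesis by (rule bexI) simp
  next
    assume "tree_colour b {a, c} \<noteq> tree_colour b {d, e}"
    then have "inj_on (tree_colour b) {{a, b}, {a, c}, {b, c}, {d, e}}"
      by (intro inj_on_four lev mem)
    then show ?thesis by (rule bexI) simp
  qed
qed

lemma detached_rainbow:
  assumes det: "detached a b c" and dist: "distinct [a, b, c, d, e]"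
  shows "\<exists>u\<in>{a, b, d, e}. inj_on (tree_colour u) {{a, b}, {a, c}, {b, c}, {d, e}}"
proof -
  have "a < b" using det by (simp add: detached_def)
  moreover have "d \<noteq> a" "e \<noteq> a" using dist by auto
  \<comment> \<open>A vertex other than \<open>a\<close> that is not strictly between
    \<open>a\<close> and \<open>b\<close> is below both or below neither.\<close>
  ultimately have "a < d \<and> d < b \<or> (d < a) = (d < b)" "a < e \<and> e < b \<or> (e < a) = (e < b)"
    by auto
  then consider "a < d" "d < b" | "a < e" "e < b" | "(d < a) = (d < b)" "(e < a) = (e < b)"
    by blast
  then show ?thesis
  proof cases
    case 1
    from rainbow_between[OF det dist this] show ?thesis by (rule bexI) simp
  next
    case 2
    have "distinct [a, b, c, e, d]" using dist by auto
    from rainbow_between[OF det this 2, unfolded insert_commute[of e d "{}"]] show ?thesis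
      by (rule bexI) simp
  next
    case 3
    from rainbow_endpoint[OF det dist this] obtain u
      where u: "u \<in> {a, b}" and inj: "inj_on (tree_colour u) {{a, b}, {a, c}, {b, c}, {d, e}}"
      by (rule bexE)
    from u have "u \<in> {a, b, d, e}" by auto
    with inj show ?thesis by (rule bexI)
  qed
qed

lemma local_collection_tree_colour: "local_collection n triangle_plus_edge tree_colour"
  unfolding local_collection_def
proof
  fix T assume "T \<in> copies triangle_plus_edge (complete_graph n)"
  then obtain \<phi> :: "nat \<Rightarrow> nat" where bij: "bij_betw \<phi> {0, 1, 2, 3, 4} (verts T)"
    and edges: "(\<lambda>e. \<phi> ` e) ` {{0, 1}, {0, 2}, {1, 2}, {3, 4}} = edges T"
    by (auto simp only: copies_def mem_Collect_eq graph_iso_def triangle_plus_edge_def fst_conv snd_conv)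
  have dist: "distinct [\<phi> 0, \<phi> 1, \<phi> 2, \<phi> 3, \<phi> 4]"
    using bij by (auto simp: bij_betw_def inj_on_def)
  have V: "verts T = {\<phi> 0, \<phi> 1, \<phi> 2, \<phi> 3, \<phi> 4}"
    using bij by (auto simp: bij_betw_def)
  have E: "edges T = {{\<phi> 0, \<phi> 1}, {\<phi> 0, \<phi> 2}, {\<phi> 1, \<phi> 2}} \<union> {{\<phi> 3, \<phi> 4}}"
    unfolding edges[symmetric] by (simp add: insert_commute)
  have "\<phi> 0 \<noteq> \<phi> 1" "\<phi> 0 \<noteq> \<phi> 2" "\<phi> 1 \<noteq> \<phi> 2" using dist by simp_all
  then obtain p q r where det: "detached p q r" and v: "{p, q, r} = {\<phi> 0, \<phi> 1, \<phi> 2}"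
    and e: "{{p, q}, {p, r}, {q, r}} = {{\<phi> 0, \<phi> 1}, {\<phi> 0, \<phi> 2}, {\<phi> 1, \<phi> 2}}"
    by (rule detached_exists)
  have "p < q" "r < p \<or> q < r" using det by (simp_all add: detached_def)
  then have "p \<noteq> q" "p \<noteq> r" "q \<noteq> r" by linarith+
  moreover have "\<phi> 3 \<notin> {p, q, r}" "\<phi> 4 \<notin> {p, q, r}" "\<phi> 3 \<noteq> \<phi> 4"
    unfolding v using dist by (simp_all add: eq_commute)
  ultimately have "distinct [p, q, r, \<phi> 3, \<phi> 4]" by (simp add: eq_commute)
  from detached_rainbow[OF det this] obtain u where u: "u \<in> {p, q, \<phi> 3, \<phi> 4}"
    and inj: "inj_on (tree_colour u) {{p, q}, {p, r}, {q, r}, {\<phi> 3, \<phi> 4}}"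
    by (rule bexE)
  have "edges T = {{p, q}, {p, r}, {q, r}, {\<phi> 3, \<phi> 4}}"
    unfolding E e[symmetric] by (simp add: insert_commute)
  with inj have "inj_on (tree_colour u) (edges T)" by (simp only:)
  moreover have "verts T = {p, q, r} \<union> {\<phi> 3, \<phi> 4}" unfolding v V by auto
  with u have "u \<in> verts T" by blast
  ultimately show "\<exists>u\<in>verts T. inj_on (tree_colour u) (edges T)" by blast
qed

section \<open>Counting colours\<close>

lemma uses_at_most_tree_colour:
  assumes "n \<le> 2 ^ L"
  shows "uses_at_most (6 * (L + 1)) n tree_colour"
  unfolding uses_at_most_def
proof
  fix u
  let ?C = "{..L} \<times> (UNIV :: bool set) \<times> {..2::nat}"
  have "tree_colour u ` edges (complete_graph n) \<subseteq> to_nat ` ?C"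
  proof
    fix k assume "k \<in> tree_colour u ` edges (complete_graph n)"
    then obtain e where k: "k = tree_colour u e" and e: "e \<subseteq> {..<n}" "card e = 2"
      by (auto simp: complete_graph_def)
    then obtain x y where xy: "e = {x, y}" by (auto simp: card_2_iff)
    then have "x < 2 ^ L" "y < 2 ^ L" using e assms by auto
    \<comment> \<open>All leaves below \<open>2 ^ L\<close> have the ancestor \<open>0\<close> at
      height \<open>L\<close>.\<close>
    then have "level e \<le> L" by (simp add: xy level_le_iff)
    moreover have "card {v \<in> e. v < u} \<le> 2"
      using card_mono[of e "{v \<in> e. v < u}"] e xy by auto
    ultimately show "k \<in> to_nat ` ?C" by (simp add: k tree_colour_def)
  qed
  then have "card (tree_colour u ` edges (complete_graph n)) \<le> card (to_nat ` ?C)"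
    by (intro card_mono) auto
  also have "\<dots> \<le> card ?C" by (intro card_image_le) auto
  also have "\<dots> = 6 * (L + 1)" by (simp add: card_cartesian_product)
  finally show "card (tree_colour u ` edges (complete_graph n)) \<le> 6 * (L + 1)" .
qed

lemma local_colour_number_le:
  assumes "n \<le> 2 ^ L"
  shows "local_colour_number n triangle_plus_edge \<le> 6 * (L + 1)"
  unfolding local_colour_number_def
  using local_collection_tree_colour uses_at_most_tree_colour[OF assms]
  by (intro Least_le) blast

theorem theorem2p3:
  shows "(\<lambda>n. real (local_colour_number n triangle_plus_edge)) \<in> O(\<lambda>n. ln (real n))"
proof (rule landau_o.bigI)
  \<comment> \<open>The ceiling and the extra level each add at most \<open>1\<close>, hence at most
    \<open>log 2 n\<close> once \<open>n\<close> is at least \<open>2\<close>. This gives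
    \<open>18 = 6 * 3\<close>, and \<open>ln 2\<close> changes the base.\<close>
  show "0 < 18 / ln (2::real)" by simp
  show "\<forall>\<^sub>F n in sequentially. norm (real (local_colour_number n triangle_plus_edge))
          \<le> 18 / ln 2 * norm (ln (real n))"
  proof (rule eventually_sequentiallyI)
    fix n :: nat assume n: "2 \<le> n"
    define L where "L = nat \<lceil>log 2 n\<rceil>"
    have log: "1 \<le> log 2 n" using n by simp
    have "log 2 n \<le> L" unfolding L_def by (rule real_nat_ceiling_ge)
    then have "real n \<le> 2 ^ L" using n by (simp add: log_le_iff powr_realpow)
    then have "n \<le> 2 ^ L" by (metis of_nat_le_iff of_nat_numeral of_nat_power)
    from local_colour_number_le[OF this]
    have "real (local_colour_number n triangle_plus_edge) \<le> real (6 * (L + 1))"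
      by (simp only: of_nat_le_iff)
    also have "\<dots> = 6 * (real L + 1)" by simp
    also have "\<dots> \<le> 18 * log 2 n"
    proof -
      have "real L = \<lceil>log 2 n\<rceil>" using log by (simp add: L_def)
      then have "real L + 1 \<le> 3 * log 2 n"
        using log of_int_ceiling_le_add_one[of "log 2 n"] by linarith
      then show ?thesis by simp
    qed
    finally show "norm (real (local_colour_number n triangle_plus_edge))
        \<le> 18 / ln 2 * norm (ln (real n))"
      using n by (simp add: log_def)
  qed
qed

end
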